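(* Let $\mathbb{F}=\mathbb{R}$ or $\mathbb{F}=\mathbb{C}$. For an arbitrary $w\in\mathbb{F}$ with $|w|>1$, the unbounded linear weighted backward shift operator \[ A_wx:=(w^kx_{k+1})_{k\in\mathbb{N}} \] in the space $c(\mathbb{N})$ with maximal domain \[ D(A_w):=\left\{x=(x_k)_{k\in\mathbb{N}}\in c(\mathbb{N}) : (w^kx_{k+1})_{k\in\mathbb{N}}\in c(\mathbb{N})\right\} \] is not hypercyclic.
   Context: $\mathbb{N}=\{1,2,3,\dots\}$, $\mathbb{Z}_+=\{0,1,2,\dots\}$. $c(\mathbb{N})$ is the Banach space of $\mathbb{F}$-valued sequences $(x_k)_{k\in\mathbb{N}}$ for which $\lim_{k\to\infty}x_k$ exists in $\mathbb{F}$, with the norm $\|x\|_\infty=\sup_{k\in\mathbb{N}}|x_k|$. Powers of an unbounded operator $A$ with domain $D(A)$ have their natural domains: $A^0:=I$ and $D(A^{n+1})=\{x\in D(A^n): A^nx\in D(A)\}$. For a (bounded or unbounded) linear operator $A$ with domain $D(A)$ in a real or complex Banach space $X$, put $C^\infty(A):=\bigcap_{n=0}^\infty D(A^n)$. A nonzero vector $x\in C^\infty(A)$ is hypercyclic for $A$ if its orbit $\{A^nx\}_{n\in\mathbb{Z}_+}$ is dense in $X$; $A$ is hypercyclic if it possesses a hypercyclic vector. *)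

theory Defs
  imports "HOL-Analysis.Analysis"
begin

section \<open>The Banach space of convergent sequences\<close>

text \<open>
  Mathematically, the sequences in c(N) are indexed by 1, 2, 3, ...; here the entry with index k + 1 is
  stored at position k :: nat.  The scalar field is a type parameter, instantiated with
  \<^typ>\<open>real\<close> and \<^typ>\<open>complex\<close>.  The class \<^class>\<open>banach\<close> only records the underlying real
  Banach space; this determines the norm topology, and hence density of orbits.
\<close>

typedef (overloaded) ('a::real_normed_vector) cseq = "{x :: nat \<Rightarrow> 'a. convergent x}"
  morphisms entry Abs_cseq
  by (rule exI[of _ "\<lambda>_. 0"]) (simp add: convergent_const)

setup_lifting type_definition_cseq

lemma cseq_eqI: "(\<And>k. entry x k = entry y k) \<Longrightarrow> x = y"
  by transfer auto

lemma bdd_above_norm_entry: "bdd_above (range (\<lambda>k. norm (entry x k)))"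
proof -
  have "Bseq (entry x)"
    using entry[of x] by (auto intro: convergent_imp_Bseq)
  then show ?thesis
    by (auto simp: Bseq_def intro: bdd_aboveI)
qed

instantiation cseq :: (real_normed_vector) real_vector
begin

lift_definition zero_cseq :: "'a cseq" is "\<lambda>_. 0"
  by (simp add: convergent_const)

lift_definition plus_cseq :: "'a cseq \<Rightarrow> 'a cseq \<Rightarrow> 'a cseq" is "\<lambda>x y k. x k + y k"
  by (rule convergent_add)

lift_definition uminus_cseq :: "'a cseq \<Rightarrow> 'a cseq" is "\<lambda>x k. - x k"
  by (simp add: convergent_minus_iff[symmetric])

lift_definition minus_cseq :: "'a cseq \<Rightarrow> 'a cseq \<Rightarrow> 'a cseq" is "\<lambda>x y k. x k - y k"
  by (rule convergent_diff)

lift_definition scaleR_cseq :: "real \<Rightarrow> 'a cseq \<Rightarrow> 'a cseq" is "\<lambda>r x k. r *\<^sub>R x k"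
  unfolding convergent_def by (elim exE, rule exI, rule tendsto_scaleR[OF tendsto_const])

instance
  by standard (transfer; auto simp: algebra_simps)+

end

lemmas entry_simps [simp] =
  zero_cseq.rep_eq plus_cseq.rep_eq uminus_cseq.rep_eq minus_cseq.rep_eq scaleR_cseq.rep_eq

instantiation cseq :: (real_normed_vector) real_normed_vector
begin

definition norm_cseq :: "'a cseq \<Rightarrow> real"
  where "norm_cseq x = (SUP k. norm (entry x k))"

definition dist_cseq :: "'a cseq \<Rightarrow> 'a cseq \<Rightarrow> real"
  where "dist_cseq x y = norm (x - y)"

definition sgn_cseq :: "'a cseq \<Rightarrow> 'a cseq"
  where "sgn_cseq x = x /\<^sub>R norm x"

definition uniformity_cseq :: "('a cseq \<times> 'a cseq) filter"
  where "uniformity_cseq = (INF e\<in>{0 <..}. principal {(x, y). dist x y < e})"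

definition open_cseq :: "'a cseq set \<Rightarrow> bool"
  where "open_cseq S = (\<forall>x\<in>S. \<forall>\<^sub>F (x', y) in uniformity. x' = x \<longrightarrow> y \<in> S)"

lemma norm_entry_le: "norm (entry x k) \<le> norm (x :: 'a cseq)"
  unfolding norm_cseq_def by (rule cSUP_upper[OF UNIV_I bdd_above_norm_entry])

lemma norm_cseq_le: "(\<And>k. norm (entry x k) \<le> b) \<Longrightarrow> norm (x :: 'a cseq) \<le> b"
  unfolding norm_cseq_def by (rule cSUP_least) auto

instance
proof
  fix x y :: "'a cseq" and a :: real
  show "(norm x = 0) = (x = 0)"
  proof
    assume "norm x = 0"
    then have "norm (entry x k) \<le> 0" for k
      using norm_entry_le[of x k] by simp
    then show "x = 0"
      by (intro cseq_eqI) simp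
  qed (simp add: norm_cseq_def)
  show "norm (x + y) \<le> norm x + norm y"
    by (rule norm_cseq_le) (auto intro!: norm_triangle_le add_mono norm_entry_le)
  show "norm (a *\<^sub>R x) = \<bar>a\<bar> * norm x"
  proof (rule antisym)
    show le: "norm (a *\<^sub>R x) \<le> \<bar>a\<bar> * norm x"
      by (rule norm_cseq_le) (auto intro!: mult_left_mono norm_entry_le)
    show "\<bar>a\<bar> * norm x \<le> norm (a *\<^sub>R x)"
    proof (cases "a = 0")
      case False
      have "norm x \<le> norm (a *\<^sub>R x) / \<bar>a\<bar>"
      proof (rule norm_cseq_le)
        fix k
        show "norm (entry x k) \<le> norm (a *\<^sub>R x) / \<bar>a\<bar>"
          using norm_entry_le[of "a *\<^sub>R x" k] False by (simp add: field_simps)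
      qed
      then show ?thesis
        using False by (simp add: field_simps)
    next
      case True
      then show ?thesis
        using norm_entry_le[of "a *\<^sub>R x" 0] by simp
    qed
  qed
qed (rule dist_cseq_def sgn_cseq_def uniformity_cseq_def open_cseq_def)+

end

instance cseq :: (banach) banach
proof
  fix f :: "nat \<Rightarrow> 'a cseq"
  assume C: "Cauchy f"
  have dist_entry: "dist (entry x k) (entry y k) \<le> dist x y" for x y :: "'a cseq" and k
    using norm_entry_le[of "x - y" k] by (simp add: dist_norm)
  have "uniformly_convergent_on UNIV (\<lambda>n. entry (f n))"
  proof (rule Cauchy_uniformly_convergent, unfold uniformly_Cauchy_on_def, intro allI impI)
    fix e :: real
    assume "e > 0"
    then obtain M where "\<forall>m\<ge>M. \<forall>n\<ge>M. dist (f m) (f n) < e"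
      using C unfolding Cauchy_def by blast
    then show "\<exists>M. \<forall>k\<in>UNIV. \<forall>m\<ge>M. \<forall>n\<ge>M. dist (entry (f m) k) (entry (f n) k) < e"
      by (meson dist_entry le_less_trans)
  qed
  then obtain g where g: "uniform_limit UNIV (\<lambda>n. entry (f n)) g sequentially"
    by (auto simp: uniformly_convergent_on_def)
  have "Cauchy g"
  proof (rule metric_CauchyI)
    fix e :: real
    assume "e > 0"
    then have "\<forall>\<^sub>F n in sequentially. \<forall>k\<in>UNIV. dist (entry (f n) k) (g k) < e / 3"
      by (intro uniform_limitD[OF g]) auto
    then obtain n where n: "\<And>k. dist (entry (f n) k) (g k) < e / 3"
      by (auto simp: eventually_sequentially)
    have "Cauchy (entry (f n))"
      using entry[of "f n"] by (auto intro: convergent_Cauchy)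
    then obtain M where M: "\<And>j k. j \<ge> M \<Longrightarrow> k \<ge> M \<Longrightarrow> dist (entry (f n) j) (entry (f n) k) < e / 3"
      using metric_CauchyD[of "entry (f n)" "e / 3"] \<open>e > 0\<close> by auto
    have "dist (g j) (g k) < e" if "j \<ge> M" "k \<ge> M" for j k
      using dist_triangle_third[of "g j" "entry (f n) j" e "entry (f n) k" "g k"]
        n[of j] n[of k] M[OF that] by (simp add: dist_commute)
    then show "\<exists>M. \<forall>j\<ge>M. \<forall>k\<ge>M. dist (g j) (g k) < e"
      by blast
  qed
  then have entry_g: "entry (Abs_cseq g) = g"
    by (intro Abs_cseq_inverse) (simp add: Cauchy_convergent)
  have "f \<longlonglongrightarrow> Abs_cseq g"
  proof (rule tendstoI)
    fix e :: real
    assume "e > 0"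
    then have "\<forall>\<^sub>F n in sequentially. \<forall>k\<in>UNIV. dist (entry (f n) k) (g k) < e / 2"
      by (intro uniform_limitD[OF g]) auto
    then show "\<forall>\<^sub>F n in sequentially. dist (f n) (Abs_cseq g) < e"
    proof eventually_elim
      case (elim n)
      then have "norm (f n - Abs_cseq g) \<le> e / 2"
        by (intro norm_cseq_le) (simp add: entry_g dist_norm less_imp_le)
      with \<open>e > 0\<close> show ?case
        by (simp add: dist_norm)
    qed
  qed
  then show "convergent f"
    by (rule convergentI)
qed


section \<open>Hypercyclicity of unbounded operators\<close>

text \<open>
  An operator in X is given by its domain D and a total function A, whose values outside D are
  irrelevant: the orbit of a vector x is only considered if every iterate of x lies in D.
\<close>

primrec pow_domain :: "'x set \<Rightarrow> ('x \<Rightarrow> 'x) \<Rightarrow> nat \<Rightarrow> 'x set"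
  where
    "pow_domain D A 0 = UNIV"
  | "pow_domain D A (Suc n) = {x \<in> pow_domain D A n. (A ^^ n) x \<in> D}"

definition C_infinity :: "'x set \<Rightarrow> ('x \<Rightarrow> 'x) \<Rightarrow> 'x set"
  where "C_infinity D A = (\<Inter>n. pow_domain D A n)"

definition hypercyclic_vector :: "'x::banach set \<Rightarrow> ('x \<Rightarrow> 'x) \<Rightarrow> 'x \<Rightarrow> bool"
  where "hypercyclic_vector D A x \<longleftrightarrow>
    x \<in> C_infinity D A \<and> x \<noteq> 0 \<and> closure (range (\<lambda>n. (A ^^ n) x)) = UNIV"

definition hypercyclic :: "'x::banach set \<Rightarrow> ('x \<Rightarrow> 'x) \<Rightarrow> bool"
  where "hypercyclic D A \<longleftrightarrow> (\<exists>x. hypercyclic_vector D A x)"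


section \<open>The weighted backward shift\<close>

text \<open>Position k carries the index k + 1, so the weight at position k is \<open>w ^ (k + 1)\<close>.\<close>

definition weighted_shift_seq :: "'a::{real_normed_field, banach} \<Rightarrow> 'a cseq \<Rightarrow> nat \<Rightarrow> 'a"
  where "weighted_shift_seq w x = (\<lambda>k. w ^ (k + 1) * entry x (k + 1))"

definition weighted_shift_domain :: "'a::{real_normed_field, banach} \<Rightarrow> 'a cseq set"
  where "weighted_shift_domain w = {x. convergent (weighted_shift_seq w x)}"

definition weighted_shift :: "'a::{real_normed_field, banach} \<Rightarrow> 'a cseq \<Rightarrow> 'a cseq"
  where "weighted_shift w x = Abs_cseq (weighted_shift_seq w x)"

lemma entry_weighted_shift:
  "x \<in> weighted_shift_domain w \<Longrightarrow> entry (weighted_shift w x) k = w ^ (k + 1) * entry x (k + 1)"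
  by (simp add: weighted_shift_def weighted_shift_domain_def Abs_cseq_inverse weighted_shift_seq_def)

end

theory Submission
  imports Defs
begin

text \<open>
  Membership in the domain of the weighted shift is a decay condition: if
  \<open>w ^ k * x (k + 1)\<close> converges as \<open>k\<close> grows and \<open>norm w > 1\<close>, then \<open>x (k + 1)\<close> is a
  convergent sequence times the null sequence \<open>(1 / w) ^ k\<close>, so \<open>x\<close> lies in the
  space \<open>c\<^sub>0\<close> of null sequences.  An orbit that can be continued for ever consists of
  elements of the domain, hence is contained in \<open>c\<^sub>0\<close>.  But \<open>c\<^sub>0\<close> is not dense in
  \<open>c\<close>: the constant sequence \<open>1\<close> has distance at least \<open>1\<close> from it.  The argument works over
  every complete normed field, and so for the reals and the complex numbers at once.
\<close>

lemma weighted_shift_domain_imp_null: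
  fixes w :: "'a::{real_normed_field, banach}"
  assumes w: "norm w > 1" and x: "x \<in> weighted_shift_domain w"
  shows "entry x \<longlonglongrightarrow> 0"
proof -
  obtain L where L: "weighted_shift_seq w x \<longlonglongrightarrow> L"
    using x by (auto simp: weighted_shift_domain_def convergent_def)
  have "(\<lambda>k. inverse w ^ k) \<longlonglongrightarrow> 0"
    using w by (intro LIMSEQ_power_zero) (simp add: norm_inverse inverse_less_1_iff)
  then have "(\<lambda>k. inverse w ^ Suc k) \<longlonglongrightarrow> 0"
    by (rule LIMSEQ_Suc)
  then have "(\<lambda>k. inverse w ^ Suc k * weighted_shift_seq w x k) \<longlonglongrightarrow> 0 * L"
    using L by (rule tendsto_mult)
  moreover have "inverse w ^ Suc k * weighted_shift_seq w x k = entry x (Suc k)" for k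
  proof -
    have "w \<noteq> 0"
      using w by auto
    then show ?thesis
      by (simp add: weighted_shift_seq_def field_simps)
  qed
  ultimately have "(\<lambda>k. entry x (Suc k)) \<longlonglongrightarrow> 0"
    by simp
  then show ?thesis
    by (rule LIMSEQ_imp_Suc)
qed

lemma C_infinity_orbit_in_domain:
  assumes "x \<in> C_infinity D A"
  shows "(A ^^ n) x \<in> D"
proof -
  have "x \<in> pow_domain D A (Suc n)"
    using assms unfolding C_infinity_def by blast
  then show ?thesis
    by simp
qed

lemma norm_limit_le_norm_cseq:
  assumes "entry x \<longlonglongrightarrow> l"
  shows "norm l \<le> norm x"
  using tendsto_norm[OF assms] by (rule LIMSEQ_le_const2) (blast intro: norm_entry_le)

lemma null_cseqs_not_dense:
  fixes S :: "'a::{real_normed_field, banach} cseq set"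
  assumes null: "\<And>x. x \<in> S \<Longrightarrow> entry x \<longlonglongrightarrow> 0"
  shows "closure S \<noteq> UNIV"
proof
  assume dense: "closure S = UNIV"
  define one :: "'a cseq" where "one = Abs_cseq (\<lambda>_. 1)"
  have entry_one: "entry one = (\<lambda>_. 1)"
    by (simp add: one_def Abs_cseq_inverse convergent_const)
  have "one \<in> closure S"
    by (simp add: dense)
  then obtain x where x: "x \<in> S" "dist x one < 1"
    unfolding closure_approachable using zero_less_one by blast
  have "(\<lambda>k. entry x k - 1) \<longlonglongrightarrow> 0 - 1"
    by (intro tendsto_diff null x(1) tendsto_const)
  then have "entry (x - one) \<longlonglongrightarrow> 0 - 1"
    by (simp add: entry_one)
  then have "norm (0 - 1 :: 'a) \<le> norm (x - one)"
    by (rule norm_limit_le_norm_cseq)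
  with x(2) show False
    by (simp add: dist_norm)
qed

lemma weighted_shift_not_hypercyclic:
  fixes w :: "'a::{real_normed_field, banach}"
  assumes w: "norm w > 1"
  shows "\<not> hypercyclic (weighted_shift_domain w) (weighted_shift w)"
proof
  assume "hypercyclic (weighted_shift_domain w) (weighted_shift w)"
  then obtain x where x: "x \<in> C_infinity (weighted_shift_domain w) (weighted_shift w)"
    and dense: "closure (range (\<lambda>n. (weighted_shift w ^^ n) x)) = UNIV"
    by (auto simp: hypercyclic_def hypercyclic_vector_def)
  have "entry y \<longlonglongrightarrow> 0" if "y \<in> range (\<lambda>n. (weighted_shift w ^^ n) x)" for y
    using that weighted_shift_domain_imp_null[OF w C_infinity_orbit_in_domain[OF x]] by blast
  then show False
    using null_cseqs_not_dense dense by blast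
qed

theorem proposition4p2:
  shows "(\<forall>w::real. norm w > 1 \<longrightarrow>
            \<not> hypercyclic (weighted_shift_domain w) (weighted_shift w)) \<and>
         (\<forall>w::complex. norm w > 1 \<longrightarrow>
            \<not> hypercyclic (weighted_shift_domain w) (weighted_shift w))"
  by (intro conjI allI impI weighted_shift_not_hypercyclic)

end
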